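(* Let $n$ and $r$ be nonnegative integers, and let $G$ be an $(n+r+2)$-connected graph. If the isolated toughness of $G$ satisfies $I(G)>\frac{n+r+3}{2(r+2)}$, then $G$ is $(P_{\geq2},n)$-factor critical avoidable; that is, for every $W\subseteq V(G)$ with $|W|=n$ and every edge $e\in E(G-W)$, the graph $G-W-e$ has a $P_{\geq 2}$-factor.
   Context: All graphs are finite, undirected and simple. For $X\subseteq V(G)$, $G-X$ is obtained by deleting the vertices of $X$; for an edge $e$, $G-e$ deletes $e$. $i(G)$ denotes the number of isolated vertices of $G$. The isolated toughness of $G$ is $I(G)=+\infty$ if $G$ is complete, and otherwise $I(G)=\min\{|X|/i(G-X): X\subseteq V(G),\ i(G-X)\geq 2\}$. A path factor of $G$ is a spanning subgraph every component of which is a path of order at least 2; for an integer $k\geq2$, a $P_{\geq k}$-factor is a path factor each of whose components has at least $k$ vertices. $G$ is $P_{\geq k}$-factor avoidable if for every $e\in E(G)$, $G$ has a $P_{\geq k}$-factor not containing $e$. $G$ is $(P_{\geq k},n)$-factor critical avoidable if for every $W\subseteq V(G)$ with $|W|=n$, $G-W$ is $P_{\geq k}$-factor avoidable. *)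

theory Defs
  imports "Graph_Theory.Graph_Theory" "HOL-Library.Extended_Real"
begin

text \<open>
  A finite simple undirected graph is a \<^const>\<open>pair_graph\<close>: an undirected edge \<open>uv\<close> is
  represented by the two arcs \<open>(u,v)\<close> and \<open>(v,u)\<close>.
\<close>

definition delete_verts :: "'a pair_pre_digraph \<Rightarrow> 'a set \<Rightarrow> 'a pair_pre_digraph" where
  "delete_verts G X =
    \<lparr> pverts = pverts G - X, parcs = {(u, v) \<in> parcs G. u \<notin> X \<and> v \<notin> X} \<rparr>"

definition delete_edge :: "'a pair_pre_digraph \<Rightarrow> 'a \<times> 'a \<Rightarrow> 'a pair_pre_digraph" where
  "delete_edge G e = \<lparr> pverts = pverts G, parcs = parcs G - {e, prod.swap e} \<rparr>"

definition k_connected :: "nat \<Rightarrow> 'a pair_pre_digraph \<Rightarrow> bool" where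
  "k_connected k G \<longleftrightarrow> k < card (pverts G) \<and>
    (\<forall>X \<subseteq> pverts G. card X < k \<longrightarrow> Digraph_Component.connected (delete_verts G X))"

definition num_isolated :: "'a pair_pre_digraph \<Rightarrow> nat" where
  "num_isolated G = card {v \<in> pverts G. \<forall>u. (v, u) \<notin> parcs G}"

definition isolated_toughness :: "'a pair_pre_digraph \<Rightarrow> ereal" where
  "isolated_toughness G =
    (if complete_digraph (card (pverts G)) G then \<infinity>
     else Min {ereal (real (card X) / real (num_isolated (delete_verts G X))) | X.
                 X \<subseteq> pverts G \<and> 2 \<le> num_isolated (delete_verts G X)})"

definition path_graph :: "('a, 'b) pre_digraph \<Rightarrow> bool" where
  "path_graph P \<longleftrightarrow> (\<exists>p. p \<noteq> [] \<and> distinct p \<and> verts P = set p \<and>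
    arcs_ends P = set (vwalk_arcs p) \<union> (set (vwalk_arcs p))\<inverse>)"

text \<open>
  The connected components of a symmetric digraph are its strongly connected components.
\<close>

definition path_factor :: "'a pair_pre_digraph \<Rightarrow> 'a pair_pre_digraph \<Rightarrow> bool" where
  "path_factor F G \<longleftrightarrow> pair_graph F \<and> spanning F G \<and>
    (\<forall>C \<in> pre_digraph.sccs F. path_graph C \<and> 2 \<le> card (verts C))"

definition path_factor_ge :: "nat \<Rightarrow> 'a pair_pre_digraph \<Rightarrow> 'a pair_pre_digraph \<Rightarrow> bool" where
  "path_factor_ge k F G \<longleftrightarrow> path_factor F G \<and>
    (\<forall>C \<in> pre_digraph.sccs F. k \<le> card (verts C))"

definition path_factor_avoidable :: "nat \<Rightarrow> 'a pair_pre_digraph \<Rightarrow> bool" where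
  "path_factor_avoidable k G \<longleftrightarrow>
    (\<forall>e \<in> parcs G. \<exists>F. path_factor_ge k F G \<and> e \<notin> parcs F)"

definition path_factor_critical_avoidable :: "nat \<Rightarrow> nat \<Rightarrow> 'a pair_pre_digraph \<Rightarrow> bool" where
  "path_factor_critical_avoidable k n G \<longleftrightarrow>
    (\<forall>W \<subseteq> pverts G. card W = n \<longrightarrow> path_factor_avoidable k (delete_verts G W))"

lemma with_proj_delete_verts:
  "with_proj (delete_verts G X) =
    induce_subgraph (with_proj G) (pverts G - X)"
  if "pair_wf_digraph G"
  using that
  by (auto simp: delete_verts_def with_proj_def induce_subgraph_def
      dest: pair_wf_digraph.in_arcsD1 pair_wf_digraph.in_arcsD2)

lemma pair_graph_delete_verts:
  assumes "pair_graph G"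
  shows "pair_graph (delete_verts G X)"
proof -
  interpret pair_graph G by fact
  show ?thesis
  proof
    show "symmetric (with_proj (delete_verts G X))"
      by (auto simp: symmetric_def delete_verts_def intro!: symI arcs_symmetric)
    show "finite (parcs (delete_verts G X))"
      by (rule finite_subset[OF _ pair_finite_arcs]) (auto simp: delete_verts_def)
  qed (auto simp: delete_verts_def dest: in_arcsD1 in_arcsD2 no_loops' intro: pair_finite_verts pair_finite_arcs)
qed

lemma pair_graph_delete_edge:
  assumes "pair_graph G"
  shows "pair_graph (delete_edge G e)"
proof -
  interpret pair_graph G by fact
  show ?thesis
  proof
    show "symmetric (with_proj (delete_edge G e))"
      by (cases e) (auto simp: symmetric_def delete_edge_def intro!: symI arcs_symmetric)
  qed (auto simp: delete_edge_def dest: in_arcsD1 in_arcsD2 no_loops' intro: pair_finite_verts pair_finite_arcs)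
qed

lemma isolated_toughness_set:
  assumes "pair_graph G"
  defines "S \<equiv> {ereal (real (card X) / real (num_isolated (delete_verts G X))) | X.
                 X \<subseteq> pverts G \<and> 2 \<le> num_isolated (delete_verts G X)}"
  shows "finite S" and "\<not> complete_digraph (card (pverts G)) G \<Longrightarrow> S \<noteq> {}"
proof -
  interpret pair_graph G by fact
  have "finite (Pow (pverts G))" using pair_finite_verts by simp
  then show "finite S"
    by (rule finite_surj[where f = "\<lambda>X. ereal (real (card X) / real (num_isolated (delete_verts G X)))"])
      (auto simp: S_def)
  assume "\<not> complete_digraph (card (pverts G)) G"
  then have "parcs G \<noteq> {(u, v). (u, v) \<in> pverts G \<times> pverts G \<and> u \<noteq> v}"
    using pair_finite_verts by (simp add: complete_digraph_pair_def)
  then obtain u v where uv: "u \<in> pverts G" "v \<in> pverts G" "u \<noteq> v" "(u, v) \<notin> parcs G"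
    by (auto dest: in_arcsD1 in_arcsD2 no_loops')
  then have "(v, u) \<notin> parcs G" by (auto dest: arcs_symmetric)
  define X where "X = pverts G - {u, v}"
  have "{w \<in> pverts (delete_verts G X). \<forall>z. (w, z) \<notin> parcs (delete_verts G X)} = {u, v}"
    using uv \<open>(v, u) \<notin> parcs G\<close>
    by (auto simp: delete_verts_def X_def dest: in_arcsD1 in_arcsD2 no_loops')
  then have "num_isolated (delete_verts G X) = 2" using uv by (simp add: num_isolated_def)
  moreover have "X \<subseteq> pverts G" by (auto simp: X_def)
  ultimately show "S \<noteq> {}" unfolding S_def by (metis (mono_tags, lifting) empty_iff mem_Collect_eq order_refl)
qed

end

theory Submission
  imports Defs
begin

text \<open>
  By the theorem of Akiyama, Avis and Era, a graph \<open>H\<close> has a path factor as soon as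
  \<open>i(H - X) \<le> 2|X|\<close> for all \<open>X\<close>. To see this, Hall's theorem turns the condition into a map
  \<open>f\<close> sending each vertex to a neighbour, with at most two preimages per vertex; the functional
  graph of \<open>f\<close> is then cut into paths by repeatedly removing an edge \<open>v f(v)\<close>, chosen so that
  at most one remaining vertex loses its image. If that vertex ends up alone, it is attached to the
  removed edge.

  If \<open>H = G - W - xy\<close> violates the condition at \<open>X\<close>, the minimum degree of \<open>G\<close> forces
  \<open>|X| \<ge> r + 2\<close>. Deleting \<open>W \<union> X \<union> {x}\<close> from \<open>G\<close> leaves at least \<open>2|X|\<close> isolated
  vertices, so \<open>I(G) \<le> (|X| + n + 1) / (2|X|) \<le> (n + r + 3) / (2(r + 2))\<close>.
\<close>

section \<open>Hall's theorem and its two-to-one variant\<close>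

text \<open>Induction on the size of \<open>I\<close>. If some nonempty proper \<open>J\<close> is
  tight, \<open>J\<close> and its complement are matched separately, the latter avoiding every
  element available to \<open>J\<close>. If none is tight, any available element may be given to one
  index, since the other indices have an element to spare.\<close>

lemma hall_marriage:
  assumes "finite I" and "\<And>i. i \<in> I \<Longrightarrow> finite (A i)"
    and "\<And>J. J \<subseteq> I \<Longrightarrow> card J \<le> card (\<Union>(A ` J))"
  shows "\<exists>g. inj_on g I \<and> (\<forall>i\<in>I. g i \<in> A i)"
  using assms
proof (induction "card I" arbitrary: I A rule: less_induct)
  case less
  note finI = less.prems(1) and finA = less.prems(2) and hall = less.prems(3)
  have finU: "finite (\<Union>(A ` J))" if "J \<subseteq> I" for J
    using that finI finA by (meson finite_UN finite_subset subsetD)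
  show ?case
  proof (cases "\<exists>J. J \<noteq> {} \<and> J \<subset> I \<and> card (\<Union>(A ` J)) = card J")
    case True
    then obtain J where J: "J \<noteq> {}" "J \<subset> I" "card (\<Union>(A ` J)) = card J" by blast
    have finJ: "finite J" using J finI finite_subset by blast
    define B where "B i = A i - \<Union>(A ` J)" for i
    have "card J < card I" using J finI by (simp add: psubset_card_mono)
    then have "\<exists>g. inj_on g J \<and> (\<forall>i\<in>J. g i \<in> A i)"
      using J finJ finA hall by (intro less.hyps) auto
    then obtain g where g: "inj_on g J" "\<forall>i\<in>J. g i \<in> A i" by blast
    have "card (I - J) < card I" using J finI by (intro psubset_card_mono) auto
    \<comment> \<open>Hall's condition for \<open>K \<union> J\<close> minus the equality for
      \<open>J\<close> is the condition for the reduced sets.\<close>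
    moreover have "card K \<le> card (\<Union>(B ` K))" if K: "K \<subseteq> I - J" for K
    proof -
      have KJ: "K \<union> J \<subseteq> I" and finK: "finite K"
        using K J finI finite_subset by blast+
      have "\<Union>(B ` K) = \<Union>(A ` (K \<union> J)) - \<Union>(A ` J)" by (auto simp: B_def)
      then have "card (\<Union>(B ` K)) = card (\<Union>(A ` (K \<union> J))) - card J"
        using finU[of J] J by (simp add: card_Diff_subset Union_mono)
      moreover have "card (K \<union> J) = card K + card J"
        using K finK finJ by (intro card_Un_disjoint) auto
      ultimately show ?thesis using hall[OF KJ] by simp
    qed
    ultimately have "\<exists>h. inj_on h (I - J) \<and> (\<forall>i\<in>I - J. h i \<in> B i)"
      using finI finA by (intro less.hyps) (auto simp: B_def)
    then obtain h where h: "inj_on h (I - J)" "\<forall>i\<in>I - J. h i \<in> B i" by blast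
    define k where "k i = (if i \<in> J then g i else h i)" for i
    have "inj_on k I"
    proof (rule inj_onI)
      fix i j assume "i \<in> I" "j \<in> I" "k i = k j"
      moreover have "g a \<noteq> h b" if "a \<in> J" "b \<in> I - J" for a b
        using g(2) h(2) that unfolding B_def by (metis DiffD2 UN_I)
      ultimately show "i = j"
        using g(1) h(1) by (cases "i \<in> J"; cases "j \<in> J") (auto simp: k_def dest: inj_onD, metis DiffI)
    qed
    moreover have "\<forall>i\<in>I. k i \<in> A i" using g h by (auto simp: k_def B_def)
    ultimately show ?thesis by blast
  next
    case False
    show ?thesis
    proof (cases "I = {}")
      case False
      then obtain i where i: "i \<in> I" by blast
      then have "card {i} \<le> card (\<Union>(A ` {i}))" by (intro hall) auto
      then have "A i \<noteq> {}" by auto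
      then obtain x where x: "x \<in> A i" by blast
      define B where "B j = A j - {x}" for j
      have "card (I - {i}) < card I" using i finI by (meson card_Diff1_less)
      moreover have "card K \<le> card (\<Union>(B ` K))" if K: "K \<subseteq> I - {i}" for K
      proof (cases "K = {}")
        case False
        have "K \<subset> I" using K i by blast
        \<comment> \<open>Without tight sets the inequality for \<open>K\<close> is strict, which
          pays for the loss of \<open>x\<close>.\<close>
        with False \<open>\<not> (\<exists>J. J \<noteq> {} \<and> J \<subset> I \<and> card (\<Union>(A ` J)) = card J)\<close> hall[of K]
        have "card K < card (\<Union>(A ` K))" by (metis le_neq_implies_less psubset_imp_subset)
        moreover have "\<Union>(B ` K) = \<Union>(A ` K) - {x}" by (auto simp: B_def)
        ultimately show ?thesis
          using card_Diff1_le[of "\<Union>(A ` K)" x] finU[of K] \<open>K \<subset> I\<close>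
          by (cases "x \<in> \<Union>(A ` K)") (auto simp: card_Diff_singleton)
      qed simp
      ultimately have "\<exists>h. inj_on h (I - {i}) \<and> (\<forall>j\<in>I - {i}. h j \<in> B j)"
        using finI finA by (intro less.hyps) (auto simp: B_def)
      then obtain h where h: "inj_on h (I - {i})" "\<forall>j\<in>I - {i}. h j \<in> B j" by blast
      have "inj_on (h(i := x)) I"
      proof (rule inj_onI)
        fix a b assume "a \<in> I" "b \<in> I" "(h(i := x)) a = (h(i := x)) b"
        then show "a = b"
          using h by (auto simp: B_def split: if_splits dest: inj_onD)
      qed
      moreover have "\<forall>j\<in>I. (h(i := x)) j \<in> A j" using h x by (auto simp: B_def)
      ultimately show ?thesis by blast
    qed simp
  qed
qed

text \<open>Pairing each element with a Boolean makes two copies of it; an injective choice among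
  the copies uses each element at most twice.\<close>

lemma hall_two_to_one:
  assumes "finite V" and "\<And>v. v \<in> V \<Longrightarrow> finite (N v)"
    and "\<And>T. T \<subseteq> V \<Longrightarrow> card T \<le> 2 * card (\<Union>(N ` T))"
  shows "\<exists>f. (\<forall>v\<in>V. f v \<in> N v) \<and> (\<forall>u. card {v \<in> V. f v = u} \<le> 2)"
proof -
  define A where "A v = N v \<times> (UNIV :: bool set)" for v
  have "card T \<le> card (\<Union>(A ` T))" if "T \<subseteq> V" for T
  proof -
    have "\<Union>(A ` T) = \<Union>(N ` T) \<times> UNIV" by (auto simp: A_def)
    then show ?thesis using assms(3)[OF that] by (simp add: card_cartesian_product)
  qed
  then have "\<exists>g. inj_on g V \<and> (\<forall>v\<in>V. g v \<in> A v)"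
    using assms by (intro hall_marriage) (auto simp: A_def)
  then obtain g where g: "inj_on g V" "\<forall>v\<in>V. g v \<in> A v" by blast
  have "card {v \<in> V. fst (g v) = u} \<le> 2" for u
  proof -
    have "card {v \<in> V. fst (g v) = u} \<le> card ({u} \<times> (UNIV :: bool set))"
    proof (rule card_inj_on_le)
      show "inj_on g {v \<in> V. fst (g v) = u}" using g(1) by (rule inj_on_subset) auto
      show "g ` {v \<in> V. fst (g v) = u} \<subseteq> {u} \<times> UNIV" by (auto simp: mem_Times_iff prod_eq_iff)
    qed auto
    then show ?thesis by (simp add: card_cartesian_product)
  qed
  moreover have "\<forall>v\<in>V. fst (g v) \<in> N v" using g(2) by (auto simp: A_def mem_Times_iff)
  ultimately show ?thesis by (intro exI[of _ "fst \<circ> g"]) auto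
qed

section \<open>Cutting a functional graph into paths\<close>

text \<open>
  One-vertex paths are allowed only inside \<open>R\<close>, the set of vertices that have lost their image
  under \<open>f\<close> in the induction below.
\<close>

definition path_partition ::
  "('a \<times> 'a) set \<Rightarrow> 'a set \<Rightarrow> 'a set \<Rightarrow> 'a list set \<Rightarrow> bool" where
  "path_partition E A R \<P> \<longleftrightarrow> (\<Union>p\<in>\<P>. set p) = A \<and>
    (\<forall>p\<in>\<P>. \<forall>q\<in>\<P>. p \<noteq> q \<longrightarrow> set p \<inter> set q = {}) \<and>
    (\<forall>p\<in>\<P>. p \<noteq> [] \<and> distinct p \<and> set (vwalk_arcs p) \<subseteq> E \<and> (2 \<le> length p \<or> set p \<subseteq> R))"

lemma path_partition_mono:
  "path_partition E A R \<P> \<Longrightarrow> R \<subseteq> R' \<Longrightarrow> path_partition E A R' \<P>"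
  unfolding path_partition_def by blast

text \<open>Puts the removed edge between \<open>b\<close> and \<open>a\<close> back. Only
  \<open>w\<close> can be in \<open>K\<close>, hence alone in \<P> without belonging to
  \<open>R\<close>. If it is alone, the edge absorbs it as \<open>[b, a, w]\<close>; otherwise
  \<open>[b, a]\<close> is a path of its own.\<close>

lemma path_partition_insert_edge:
  assumes P: "path_partition E (A - {a, b}) (R \<union> K) \<P>"
    and "a \<in> A" "b \<in> A" "a \<noteq> b" "(b, a) \<in> E"
    and K: "K \<subseteq> {w}" "\<And>x. x \<in> K \<Longrightarrow> (a, x) \<in> E"
  shows "\<exists>\<Q>. path_partition E A R \<Q>"
proof (cases "[w] \<in> \<P> \<and> w \<in> K")
  case True
  then have "w \<in> (\<Union>p\<in>\<P>. set p)" by force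
  also have "\<dots> = A - {a, b}" using P by (simp add: path_partition_def)
  finally have w: "w \<in> A - {a, b}" .
  have "path_partition E A R (insert [b, a, w] (\<P> - {[w]}))"
    unfolding path_partition_def
  proof (intro conjI)
    have "(\<Union>p\<in>\<P>. set p) = (\<Union>p\<in>\<P> - {[w]}. set p) \<union> {w}" using True by auto
    moreover have "(\<Union>p\<in>\<P>. set p) = A - {a, b}" using P by (simp add: path_partition_def)
    ultimately show "(\<Union>p\<in>insert [b, a, w] (\<P> - {[w]}). set p) = A"
      using assms(2,3) by auto
    have disj: "p \<in> \<P> \<Longrightarrow> q \<in> \<P> \<Longrightarrow> p \<noteq> q \<Longrightarrow> set p \<inter> set q = {}" for p q
      using P by (auto simp: path_partition_def)
    have "set p \<inter> {b, a, w} = {}" if "p \<in> \<P> - {[w]}" for p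
      using P that disj[of p "[w]"] True by (auto simp: path_partition_def)
    with disj show "\<forall>p\<in>insert [b, a, w] (\<P> - {[w]}). \<forall>q\<in>insert [b, a, w] (\<P> - {[w]}).
        p \<noteq> q \<longrightarrow> set p \<inter> set q = {}"
      by (simp add: Int_commute)
    \<comment> \<open>A one-vertex path outside \<open>R\<close> lies in \<open>K\<close>, so it is
      \<open>[w]\<close>, which has just been replaced.\<close>
    have "2 \<le> length p \<or> set p \<subseteq> R" if p: "p \<in> \<P> - {[w]}" for p
    proof (rule ccontr)
      assume "\<not> ?thesis"
      moreover from this have "p \<noteq> []" "set p \<subseteq> R \<union> K"
        using P p by (auto simp: path_partition_def)
      ultimately show False using p K(1) by (cases p rule: vwalk_arcs.cases) auto
    qed
    then show "\<forall>p\<in>insert [b, a, w] (\<P> - {[w]}). p \<noteq> [] \<and> distinct p \<and>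
        set (vwalk_arcs p) \<subseteq> E \<and> (2 \<le> length p \<or> set p \<subseteq> R)"
      using P assms w True by (auto simp: path_partition_def)
  qed
  then show ?thesis by blast
next
  case False
  have "path_partition E A R (insert [b, a] \<P>)"
    unfolding path_partition_def
  proof (intro conjI)
    have U: "(\<Union>p\<in>\<P>. set p) = A - {a, b}" using P by (simp add: path_partition_def)
    then show "(\<Union>p\<in>insert [b, a] \<P>. set p) = A"
      using assms(2,3) by auto
    have disj: "p \<in> \<P> \<Longrightarrow> q \<in> \<P> \<Longrightarrow> p \<noteq> q \<Longrightarrow> set p \<inter> set q = {}" for p q
      using P by (auto simp: path_partition_def)
    have "set p \<inter> {b, a} = {}" if "p \<in> \<P>" for p
      using U that by blast
    with disj show "\<forall>p\<in>insert [b, a] \<P>. \<forall>q\<in>insert [b, a] \<P>.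
        p \<noteq> q \<longrightarrow> set p \<inter> set q = {}"
      by (simp add: Int_commute)
    have "2 \<le> length p \<or> set p \<subseteq> R" if p: "p \<in> \<P>" for p
    proof (rule ccontr)
      assume "\<not> ?thesis"
      moreover from this have "p \<noteq> []" "set p \<subseteq> R \<union> K"
        using P p by (auto simp: path_partition_def)
      ultimately show False using p K(1) False by (cases p rule: vwalk_arcs.cases) auto
    qed
    then show "\<forall>p\<in>insert [b, a] \<P>. p \<noteq> [] \<and> distinct p \<and>
        set (vwalk_arcs p) \<subseteq> E \<and> (2 \<le> length p \<or> set p \<subseteq> R)"
      using P assms by (auto simp: path_partition_def)
  qed
  then show ?thesis by blast
qed

text \<open>Induction on \<open>card A\<close>, with preimages taken in \<open>A - R\<close>. A
  vertex of \<open>R\<close> without preimages becomes a path by itself; a vertex outside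
  \<open>R\<close> without preimages is removed together with its image; if neither exists, an edge
  of a permutation is removed. Each removal of an edge adds at most one vertex to
  \<open>R\<close>.\<close>

lemma path_partition_of_function:
  assumes "finite A" and "sym E" and "R \<subseteq> A"
    and "\<And>v. v \<in> A - R \<Longrightarrow> f v \<in> A \<and> f v \<noteq> v \<and> (v, f v) \<in> E"
    and "\<And>u. card {v \<in> A - R. f v = u} \<le> 2"
  shows "\<exists>\<P>. path_partition E A R \<P>"
  using assms(1,3-)
proof (induction "card A" arbitrary: A R rule: less_induct)
  case less
  note fin = less.prems(1) and RA = less.prems(2) and f = less.prems(3) and fib = less.prems(4)
  have fib': "card {v \<in> A' - R'. f v = u} \<le> 2" if "A' - R' \<subseteq> A - R" for A' R' u
  proof -
    have "card {v \<in> A' - R'. f v = u} \<le> card {v \<in> A - R. f v = u}"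
      using that fin by (intro card_mono) auto
    then show ?thesis using fib[of u] by simp
  qed
  consider (empty) "A = {}" | (root) v where "v \<in> R" "v \<notin> f ` (A - R)"
    | (leaf) v where "v \<in> A - R" "v \<notin> f ` (A - R)"
    | (cyc) "A \<noteq> {}" "A \<subseteq> f ` (A - R)"
    using RA by blast
  then show ?case
  proof cases
    case empty
    then show ?thesis by (intro exI[of _ "{}"]) (simp add: path_partition_def)
  next
    case root
    have vA: "v \<in> A" using root RA by blast
    have eq: "A - {v} - (R - {v}) = A - R" using root by blast
    have "card (A - {v}) < card A" using vA fin by (meson card_Diff1_less)
    then have "\<exists>\<P>. path_partition E (A - {v}) (R - {v}) \<P>"
    proof (rule less.hyps)
      fix u assume "u \<in> A - {v} - (R - {v})"
      with f root show "f u \<in> A - {v} \<and> f u \<noteq> u \<and> (u, f u) \<in> E" unfolding eq by auto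
    qed (use fin RA fib eq in auto)
    then obtain \<P> where P: "path_partition E (A - {v}) (R - {v}) \<P>" by blast
    have "v \<notin> set p" if "p \<in> \<P>" for p using P that by (auto simp: path_partition_def)
    with P vA root have "path_partition E A R (insert [v] \<P>)"
      unfolding path_partition_def by simp blast
    then show ?thesis by blast
  next
    case leaf
    define u where "u = f v"
    have u: "u \<in> A" "u \<noteq> v" "(v, u) \<in> E" using f leaf by (auto simp: u_def)
    \<comment> \<open>Nothing maps to \<open>v\<close>, so only the vertices of \<open>K\<close>
      lose their image. As \<open>v\<close> takes one of the at most two places in the fibre of
      \<open>u\<close>, at most one vertex is left for \<open>K\<close>.\<close>
    define K where "K = {w \<in> A - R - {u, v}. f w = u}"
    have "card (insert v K) \<le> card {w \<in> A - R. f w = u}"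
      using fin leaf by (intro card_mono) (auto simp: K_def u_def)
    moreover have "finite K" "v \<notin> K" using fin by (auto simp: K_def)
    ultimately have "card K \<le> 1" using fib[of u] by simp
    then have "\<forall>x\<in>K. \<forall>y\<in>K. x = y" using \<open>finite K\<close> by (simp add: card_le_Suc0_iff_eq)
    then obtain w where w: "K \<subseteq> {w}" by (cases "K = {}") blast+
    have "card (A - {u, v}) < card A" using u fin by (intro psubset_card_mono) auto
    then have "\<exists>\<P>. path_partition E (A - {u, v}) (R - {u, v} \<union> K) \<P>"
    proof (rule less.hyps)
      fix x assume "x \<in> A - {u, v} - (R - {u, v} \<union> K)"
      with f leaf show "f x \<in> A - {u, v} \<and> f x \<noteq> x \<and> (x, f x) \<in> E"
        by (auto simp: K_def)
    next
      show "card {w \<in> A - {u, v} - (R - {u, v} \<union> K). f w = x} \<le> 2" for x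
        by (rule fib') auto
    qed (use fin RA K_def in auto)
    then obtain \<P> where "path_partition E (A - {u, v}) (R \<union> K) \<P>"
      by (meson path_partition_mono Diff_subset Un_mono order_refl)
    moreover have "(u, x) \<in> E" if "x \<in> K" for x
      using that f[of x] \<open>sym E\<close> by (auto simp: K_def dest: symD)
    ultimately show ?thesis using u leaf w by (intro path_partition_insert_edge) auto
  next
    case cyc
    \<comment> \<open>Without leaves, \<open>f\<close> is a permutation of \<open>A\<close>.\<close>
    have "card A \<le> card (f ` (A - R))" using cyc fin by (simp add: card_mono)
    also have "\<dots> \<le> card (A - R)" using fin by (simp add: card_image_le)
    finally have "A - R = A" using fin by (intro card_subset_eq) (auto intro: card_mono le_antisym)
    then have R: "R = {}" using RA by blast
    have "f ` A = A" using cyc f R by auto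
    then have inj: "inj_on f A" using fin by (simp add: eq_card_imp_inj_on)
    obtain v where v: "v \<in> A" using cyc by blast
    define u where "u = f v"
    have u: "u \<in> A" "u \<noteq> v" "(v, u) \<in> E" using f v R by (auto simp: u_def)
    \<comment> \<open>By injectivity only \<open>v\<close> maps to \<open>u\<close>, so the removal
      costs an image only to the predecessor of \<open>v\<close>, unless that is
      \<open>u\<close>.\<close>
    define K where "K = {w \<in> A - {v, u}. f w = v}"
    obtain w where w: "K \<subseteq> {w}" using inj by (auto simp: K_def dest: inj_onD)
    have "card (A - {v, u}) < card A" using u fin by (intro psubset_card_mono) auto
    then have "\<exists>\<P>. path_partition E (A - {v, u}) K \<P>"
    proof (rule less.hyps)
      fix x assume x: "x \<in> A - {v, u} - K"
      then have "f x \<noteq> u" using inj v by (auto simp: u_def dest: inj_onD)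
      with f R x show "f x \<in> A - {v, u} \<and> f x \<noteq> x \<and> (x, f x) \<in> E"
        by (auto simp: K_def)
    next
      show "card {w \<in> A - {v, u} - K. f w = x} \<le> 2" for x
        by (rule fib') (use R in auto)
    qed (use fin K_def in auto)
    then obtain \<P> where "path_partition E (A - {v, u}) (R \<union> K) \<P>" using R by auto
    moreover have "(v, x) \<in> E" if "x \<in> K" for x
      using that f[of x] \<open>sym E\<close> R by (auto simp: K_def dest: symD)
    \<comment> \<open>The vertex that lost its image is adjacent to \<open>v\<close>, so
      \<open>v\<close> is the middle of the possible path \<open>[u, v, w]\<close>; in the case
      \<open>leaf\<close> the middle was the image \<open>u\<close>.\<close>
    ultimately show ?thesis using u v w \<open>sym E\<close>
      by (intro path_partition_insert_edge[where a = v and b = u]) (auto dest: symD)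
  qed
qed

section \<open>From path partitions to path factors\<close>

lemma vwalk_arcs_in_set: "(u, v) \<in> set (vwalk_arcs p) \<Longrightarrow> u \<in> set p \<and> v \<in> set p"
  by (induction p rule: vwalk_arcs.induct) auto

lemma (in wf_digraph) hd_reachable_vwalk:
  assumes "set p \<subseteq> verts G" "set (vwalk_arcs p) \<subseteq> arcs_ends G" "v \<in> set p"
  shows "hd p \<rightarrow>\<^sup>*\<^bsub>G\<^esub> v"
  using assms
  by (induction p rule: vwalk_arcs.induct) (auto intro: adj_reachable_trans)

text \<open>The paths, with arcs in both directions, form the factor. Disjointness keeps each arc of
  \<open>F\<close> inside one path, and the head of a path reaches all of it, so the strongly
  connected components are exactly the paths. The empty set in place of \<open>R\<close> excludes
  one-vertex paths.\<close>

lemma path_factor_of_path_partition: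
  assumes "pair_graph G" and P: "path_partition (parcs G) (pverts G) {} \<P>"
  shows "\<exists>F. path_factor_ge 2 F G"
proof -
  interpret G: pair_graph G by fact
  define arcs_of where "arcs_of p = set (vwalk_arcs p) \<union> (set (vwalk_arcs p))\<inverse>" for p :: "'a list"
  define F where "F = \<lparr> pverts = pverts G, parcs = (\<Union>p\<in>\<P>. arcs_of p) \<rparr>"
  have cover: "(\<Union>p\<in>\<P>. set p) = pverts G"
    and disj: "\<And>p q. p \<in> \<P> \<Longrightarrow> q \<in> \<P> \<Longrightarrow> p \<noteq> q \<Longrightarrow> set p \<inter> set q = {}"
    and path: "\<And>p. p \<in> \<P> \<Longrightarrow> p \<noteq> [] \<and> distinct p \<and> set (vwalk_arcs p) \<subseteq> parcs G \<and> 2 \<le> length p"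
    using P by (auto simp: path_partition_def)
  have arcs_of_in: "u \<in> set p \<and> v \<in> set p" if "(u, v) \<in> arcs_of p" for u v p
    using that by (auto simp: arcs_of_def dest: vwalk_arcs_in_set)
  have sub: "parcs F \<subseteq> parcs G"
  proof -
    have "arcs_of p \<subseteq> parcs G" if "p \<in> \<P>" for p
      using path[OF that] by (auto simp: arcs_of_def intro: G.arcs_symmetric)
    then show ?thesis by (auto simp: F_def)
  qed
  have F: "pair_graph F"
  proof
    show "symmetric (with_proj F)"
      by (auto simp: symmetric_def F_def arcs_of_def intro!: symI)
    show "finite (parcs F)" using sub G.pair_finite_arcs finite_subset by blast
    fix e assume "e \<in> parcs F"
    then have e: "(fst e, snd e) \<in> parcs G" using sub by auto
    show "fst e \<in> pverts F" "snd e \<in> pverts F" "fst e \<noteq> snd e"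
      using G.in_arcsD1[OF e] G.in_arcsD2[OF e] G.no_loops'[of "fst e"] e by (auto simp: F_def)
  qed (simp add: F_def)
  interpret F: pair_graph F by fact
  have arc_path: "(u, v) \<in> arcs_of p" if p: "p \<in> \<P>" and uv: "u \<in> set p \<or> v \<in> set p" "(u, v) \<in> parcs F" for u v p
  proof -
    obtain q where q: "q \<in> \<P>" "(u, v) \<in> arcs_of q" using uv(2) by (auto simp: F_def)
    then have "q = p" using disj[OF p q(1)] arcs_of_in[OF q(2)] uv(1) by blast
    then show ?thesis using q by simp
  qed
  have comp: "path_graph C \<and> 2 \<le> card (verts C)" if C: "C \<in> pre_digraph.sccs (with_proj F)" for C
  proof -
    obtain S where S: "S \<in> F.sccs_verts" "C = with_proj F \<restriction> S"
      using C F.sccs_conv_sccs_verts by auto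
    obtain x where x: "x \<in> S" using S(1) by (auto simp: F.sccs_verts_def)
    then have "x \<rightarrow>\<^sup>*\<^bsub>with_proj F\<^esub> x" using S(1) by (auto simp: F.sccs_verts_def)
    then have "x \<in> pverts F" using F.reachable_in_verts(1) by blast
    then obtain p where p: "p \<in> \<P>" "x \<in> set p" using cover by (auto simp: F_def)
    have inside: "y \<in> set p" if "x \<rightarrow>\<^sup>*\<^bsub>with_proj F\<^esub> y" for y
      using that
    proof (induction rule: F.reachable_induct)
      case (step y z)
      then show ?case using arc_path[OF p(1), of y z] arcs_of_in by auto
    qed (rule p(2))
    have "hd p \<rightarrow>\<^sup>*\<^bsub>with_proj F\<^esub> y" if "y \<in> set p" for y
      using that p(1) cover by (intro F.hd_reachable_vwalk) (auto simp: F_def arcs_of_def)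
    then have reach: "x \<rightarrow>\<^sup>*\<^bsub>with_proj F\<^esub> y \<and> y \<rightarrow>\<^sup>*\<^bsub>with_proj F\<^esub> x" if "y \<in> set p" for y
      using that p(2) by (meson F.symmetric_reachable' F.reachable_trans)
    have "S = set p"
    proof
      show "S \<subseteq> set p" using S(1) x inside by (auto simp: F.sccs_verts_def)
      show "set p \<subseteq> S" using S(1) x reach unfolding F.sccs_verts_def by blast
    qed
    moreover have "arcs_ends (with_proj F \<restriction> set p) = arcs_of p"
    proof -
      have "arcs_ends (with_proj F \<restriction> set p) = {(u, v) \<in> parcs F. u \<in> set p \<and> v \<in> set p}"
        by (auto simp: arcs_ends_def arc_to_ends_def)
      also have "\<dots> = arcs_of p"
      proof
        show "{(u, v) \<in> parcs F. u \<in> set p \<and> v \<in> set p} \<subseteq> arcs_of p"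
          using arc_path[OF p(1)] by blast
        show "arcs_of p \<subseteq> {(u, v) \<in> parcs F. u \<in> set p \<and> v \<in> set p}"
          using arcs_of_in p(1) by (auto simp: F_def)
      qed
      finally show ?thesis .
    qed
    ultimately have "verts C = set p" "arcs_ends C = arcs_of p" using S(2) by simp_all
    moreover have "p \<noteq> []" "distinct p" "2 \<le> card (set p)"
      using path[OF p(1)] by (simp_all add: distinct_card)
    ultimately show ?thesis unfolding path_graph_def arcs_of_def by metis
  qed
  have "spanning F G"
    unfolding spanning_def subgraph_def
    using sub G.wf_digraph_axioms F.wf_digraph_axioms by (auto simp: F_def)
  then show ?thesis
    using F comp by (auto simp: path_factor_ge_def path_factor_def)
qed

text \<open>The hard direction of the theorem of Akiyama, Avis and Era.\<close>

theorem path_factor_if_isolated_le: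
  assumes "pair_graph G"
    and iso: "\<And>S. S \<subseteq> pverts G \<Longrightarrow> num_isolated (delete_verts G S) \<le> 2 * card S"
  shows "\<exists>F. path_factor_ge 2 F G"
proof -
  interpret pair_graph G by fact
  define N where "N v = {u. (v, u) \<in> parcs G}" for v
  have NV: "N v \<subseteq> pverts G" for v by (auto simp: N_def dest: in_arcsD2)
  have "card T \<le> 2 * card (\<Union>(N ` T))" if T: "T \<subseteq> pverts G" for T
  proof -
    let ?M = "\<Union>(N ` T)"
    \<comment> \<open>Deleting \<open>S\<close> isolates each \<open>v\<close> in
      \<open>T - ?M\<close>: a neighbour of \<open>v\<close> in \<open>T\<close> would by symmetry
      put \<open>v\<close> into \<open>?M\<close>, so all neighbours lie in
      \<open>S\<close>.\<close>
    define S where "S = ?M - T"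
    have fin: "finite T" "finite ?M"
      using T NV pair_finite_verts by (meson UN_least finite_subset)+
    have "T - ?M \<subseteq> {v \<in> pverts (delete_verts G S). \<forall>u. (v, u) \<notin> parcs (delete_verts G S)}"
      using T by (auto simp: delete_verts_def S_def N_def intro: arcs_symmetric)
    then have "card (T - ?M) \<le> num_isolated (delete_verts G S)"
      unfolding num_isolated_def using pair_finite_verts
      by (intro card_mono) (auto simp: delete_verts_def)
    also have "\<dots> \<le> 2 * card S" using NV by (intro iso) (auto simp: S_def)
    finally have "card (T - ?M) \<le> 2 * card S" .
    \<comment> \<open>Both \<open>T\<close> and \<open>?M\<close> contain
      \<open>T \<inter> ?M\<close>, so bounding \<open>card (T - ?M)\<close> by
      \<open>2 * card S\<close> suffices.\<close>
    moreover have "card T = card (T - ?M) + card (T \<inter> ?M)"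
      using fin by (metis add.commute card_Diff_subset_Int card_Int_Diff)
    moreover have "card ?M = card S + card (T \<inter> ?M)"
      using fin by (metis S_def Int_commute add.commute card_Int_Diff)
    ultimately show ?thesis by simp
  qed
  then have "\<exists>f. (\<forall>v\<in>pverts G. f v \<in> N v) \<and> (\<forall>u. card {v \<in> pverts G. f v = u} \<le> 2)"
    using pair_finite_verts by (intro hall_two_to_one) (auto intro: finite_subset[OF NV])
  then obtain f where f: "\<And>v. v \<in> pverts G \<Longrightarrow> (v, f v) \<in> parcs G"
    "\<And>u. card {v \<in> pverts G. f v = u} \<le> 2" by (auto simp: N_def)
  have "f v \<noteq> v" if "v \<in> pverts G" for v using f(1)[OF that] no_loops' by metis
  moreover have "sym (parcs G)" by (auto intro: symI arcs_symmetric)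
  ultimately have "\<exists>\<P>. path_partition (parcs G) (pverts G) {} \<P>"
    using f pair_finite_verts
    by (intro path_partition_of_function[where f = f]) (auto dest: in_arcsD2)
  then show ?thesis using path_factor_of_path_partition assms(1) by blast
qed

section \<open>Minimum degree, toughness and the final count\<close>

text \<open>If \<open>v\<close> had fewer than \<open>k\<close> neighbours, deleting them would
  isolate \<open>v\<close>, while another vertex survives because there are more than
  \<open>k\<close> vertices.\<close>

lemma k_connected_card_neighbours:
  assumes "pair_graph G" and k: "k_connected k G" and v: "v \<in> pverts G"
  shows "k \<le> card {u. (v, u) \<in> parcs G}"
proof (rule ccontr)
  interpret pair_graph G by fact
  define X where "X = {u. (v, u) \<in> parcs G}"
  \<comment> \<open>Connectedness is strong connectedness of the symmetric closure, so the walk from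
    \<open>v\<close> is sought there.\<close>
  let ?H = "mk_symmetric (with_proj (delete_verts G X))"
  assume "\<not> ?thesis"
  then have less: "card X < k" by (simp add: X_def)
  have XV: "X \<subseteq> pverts G" by (auto simp: X_def dest: in_arcsD2)
  have vX: "v \<notin> X" using no_loops' by (auto simp: X_def)
  have "Digraph_Component.connected (with_proj (delete_verts G X))"
    using k XV less by (simp add: k_connected_def)
  moreover have "\<not> pverts G \<subseteq> insert v X"
  proof
    assume "pverts G \<subseteq> insert v X"
    then have "card (pverts G) \<le> card (insert v X)"
      using XV pair_finite_verts by (intro card_mono) (auto intro: finite_subset)
    also have "\<dots> \<le> k" using less XV pair_finite_verts vX by (simp add: finite_subset)
    finally show False using k by (simp add: k_connected_def)
  qed
  then obtain u where u: "u \<in> pverts G" "u \<noteq> v" "u \<notin> X" by blast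
  ultimately have "v \<rightarrow>\<^sup>*\<^bsub>with_proj ?H\<^esub> u"
    using v vX by (auto simp: connected_def strongly_connected_def mk_symmetric_def delete_verts_def)
  then have "(v, u) \<in> (parcs ?H)\<^sup>*"
    using reachable_rtranclI by fastforce
  then obtain w where "(v, w) \<in> parcs ?H" using u by (metis converse_rtranclE)
  then show False
    by (auto simp: mk_symmetric_def delete_verts_def X_def dest: arcs_symmetric)
qed

text \<open>Two vertices isolated by the deletion are not adjacent in \<open>G\<close>; thus
  \<open>G\<close> is not complete, and its toughness is the minimum over a finite set.\<close>

lemma isolated_toughness_le:
  assumes "pair_graph G" and "X \<subseteq> pverts G" and "2 \<le> num_isolated (delete_verts G X)"
  shows "isolated_toughness G \<le> ereal (real (card X) / real (num_isolated (delete_verts G X)))"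
proof -
  interpret pair_graph G by fact
  let ?I = "{v \<in> pverts (delete_verts G X). \<forall>u. (v, u) \<notin> parcs (delete_verts G X)}"
  have "\<exists>u\<in>?I. \<exists>v\<in>?I. u \<noteq> v"
    using assms(3) unfolding num_isolated_def
    by (metis (no_types, lifting) card.infinite card_le_Suc0_iff_eq not_less_eq_eq numeral_2_eq_2 zero_le)
  then have "\<not> complete_digraph (card (pverts G)) G"
    by (auto simp: complete_digraph_pair_def delete_verts_def)
  then show ?thesis
    using isolated_toughness_set(1)[OF assms(1)] assms(2,3)
    unfolding isolated_toughness_def by (auto intro!: Min_le)
qed

text \<open>The edge \<open>xy\<close> may make vertices of \<open>I\<close> adjacent in
  \<open>G\<close>. Deleting \<open>x\<close> as well adds at most one deleted vertex and loses at
  most one isolated vertex; the strictness of the assumed violation covers that loss.\<close>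

lemma num_isolated_delete_edge_le:
  assumes G: "pair_graph G" and k: "k_connected (n + r + 2) G"
    and tough: "isolated_toughness G > ereal (real (n + r + 3) / real (2 * (r + 2)))"
    and W: "W \<subseteq> pverts G" "card W = n"
    and X: "X \<subseteq> pverts G - W"
  shows "num_isolated (delete_verts (delete_edge (delete_verts G W) (x, y)) X) \<le> 2 * card X"
proof (rule ccontr)
  interpret pair_graph G by fact
  let ?H = "delete_verts (delete_edge (delete_verts G W) (x, y)) X"
  define I where "I = {v \<in> pverts ?H. \<forall>u. (v, u) \<notin> parcs ?H}"
  assume "\<not> ?thesis"
  then have I: "2 * card X < card I" by (simp add: num_isolated_def I_def)
  have finI: "finite I" using pair_finite_verts by (auto simp: I_def delete_verts_def delete_edge_def)
  have finXW: "finite X" "finite W" using X W pair_finite_verts by (auto intro: finite_subset)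
  have IV: "v \<in> pverts G - W - X" if "v \<in> I" for v
    using that by (auto simp: I_def delete_verts_def delete_edge_def)
  have nbr: "u \<in> W \<union> X \<or> (v = x \<and> u = y) \<or> (v = y \<and> u = x)" if "v \<in> I" "(v, u) \<in> parcs G" for u v
    using that by (auto simp: I_def delete_verts_def delete_edge_def)
  have deg: "n + r + 2 \<le> card B" if "v \<in> pverts G" "{u. (v, u) \<in> parcs G} \<subseteq> B" "finite B" for v B
    using k_connected_card_neighbours[OF G k that(1)] card_mono[OF that(3,2)] by simp
  have "X \<noteq> {}"
  proof
    assume "X = {}"
    obtain v where v: "v \<in> I" using I by (metis card.empty equals0I not_less_zero)
    \<comment> \<open>The other end of the edge if \<open>v\<close> is an end; for any other
      \<open>v\<close> the value \<open>x\<close> is a harmless default.\<close>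
    let ?z = "if v = x then y else x"
    have "{u. (v, u) \<in> parcs G} \<subseteq> insert ?z W" using nbr[OF v] \<open>X = {}\<close> by auto
    then have "n + r + 2 \<le> card (insert ?z W)" using IV[OF v] finXW by (intro deg) auto
    also have "\<dots> \<le> n + 1" using W finXW by (simp add: card_insert_if)
    finally show False by simp
  qed
  then have "card X \<ge> 1" using finXW by (simp add: Suc_leI card_gt_0_iff)
  \<comment> \<open>\<open>I\<close> has at least three vertices, so one of them avoids both ends
    and has all its neighbours in \<open>W \<union> X\<close>.\<close>
  then have "card {x, y} < card I" using I by (auto simp: card_insert_if)
  then obtain v where v: "v \<in> I" "v \<noteq> x" "v \<noteq> y"
    by (metis card_mono finite.emptyI finite.insertI insertCI linorder_not_less subsetI)
  have "{u. (v, u) \<in> parcs G} \<subseteq> W \<union> X" using nbr[OF v(1)] v by auto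
  then have "n + r + 2 \<le> card (W \<union> X)" using IV[OF v(1)] finXW by (intro deg) auto
  then have rX: "r + 2 \<le> card X" using card_Un_le[of W X] W by simp
  \<comment> \<open>With \<open>x\<close> deleted, \<open>y\<close> loses its possible extra
    neighbour. The intersection is taken because \<open>x\<close> is an arbitrary element, perhaps
    outside \<open>G\<close>.\<close>
  define Y where "Y = (W \<union> X \<union> {x}) \<inter> pverts G"
  have "I - {x} \<subseteq> {v \<in> pverts (delete_verts G Y). \<forall>u. (v, u) \<notin> parcs (delete_verts G Y)}"
    using IV nbr by (fastforce simp: delete_verts_def Y_def dest: in_arcsD2)
  then have "card (I - {x}) \<le> num_isolated (delete_verts G Y)"
    unfolding num_isolated_def using pair_finite_verts
    by (intro card_mono) (auto simp: delete_verts_def)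
  moreover have "card I - 1 \<le> card (I - {x})" using diff_card_le_card_Diff[of "{x}" I] by simp
  ultimately have isoY: "2 * card X \<le> num_isolated (delete_verts G Y)" using I by simp
  have "card Y \<le> card (W \<union> X \<union> {x})" using finXW by (intro card_mono) (auto simp: Y_def)
  also have "\<dots> \<le> card W + card X + 1"
    using card_Un_le[of "W \<union> X" "{x}"] card_Un_le[of W X] by simp
  finally have cardY: "card Y \<le> n + card X + 1" using W by simp
  have "isolated_toughness G \<le> ereal (real (card Y) / real (num_isolated (delete_verts G Y)))"
    using isoY rX by (intro isolated_toughness_le[OF G]) (auto simp: Y_def)
  also have "\<dots> \<le> ereal (real (n + card X + 1) / real (2 * card X))"
    unfolding ereal_less_eq
  proof (rule frac_le)
    show "real (card Y) \<le> real (n + card X + 1)" using cardY by (rule of_nat_mono)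
    show "real (2 * card X) \<le> real (num_isolated (delete_verts G Y))" using isoY by (rule of_nat_mono)
  qed (use rX in auto)
  \<comment> \<open>The quotient equals 1/2 + (n + 1) / (2 * card X), which decreases in
    \<open>card X\<close>, so its largest value is at \<open>card X = r + 2\<close>.\<close>
  also have "\<dots> \<le> ereal (real (n + r + 3) / real (2 * (r + 2)))"
  proof -
    have "(real n + 1) * (real r + 2) \<le> (real n + 1) * real (card X)"
      using rX by (intro mult_left_mono) auto
    then show ?thesis using rX by (simp add: field_simps)
  qed
  finally show False using tough by simp
qed

theorem theorem6:
  fixes G :: "'a pair_pre_digraph" and n r :: nat
  assumes "pair_graph G"
    and "k_connected (n + r + 2) G"
    and "isolated_toughness G > ereal (real (n + r + 3) / real (2 * (r + 2)))"
  shows "path_factor_critical_avoidable 2 n G \<and>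
    (\<forall>W \<subseteq> pverts G. card W = n \<longrightarrow>
      (\<forall>e \<in> parcs (delete_verts G W).
        \<exists>F. path_factor_ge 2 F (delete_edge (delete_verts G W) e)))"
proof -
  have factor: "\<exists>F. path_factor_ge 2 F (delete_edge (delete_verts G W) e)"
    if "W \<subseteq> pverts G" "card W = n" for W e
  proof (rule path_factor_if_isolated_le)
    show "pair_graph (delete_edge (delete_verts G W) e)"
      using assms(1) by (intro pair_graph_delete_edge pair_graph_delete_verts)
    fix S assume "S \<subseteq> pverts (delete_edge (delete_verts G W) e)"
    then have "S \<subseteq> pverts G - W" by (simp add: delete_edge_def delete_verts_def)
    then show "num_isolated (delete_verts (delete_edge (delete_verts G W) e) S) \<le> 2 * card S"
      using num_isolated_delete_edge_le[OF assms that] by (cases e) simp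
  qed
  \<comment> \<open>Deleting an edge keeps all vertices, so a factor of the smaller graph is also
    one of \<open>H\<close>, and it avoids \<open>e\<close>.\<close>
  moreover have "path_factor_ge 2 F H \<and> e \<notin> parcs F"
    if F: "path_factor_ge 2 F (delete_edge H e)" and H: "pair_graph H" for F H :: "'a pair_pre_digraph" and e
  proof -
    interpret H: pair_graph H by fact
    have "spanning F (delete_edge H e)" using F by (simp add: path_factor_ge_def path_factor_def)
    then have "spanning F H" "e \<notin> parcs F"
      using H.wf_digraph_axioms by (auto simp: spanning_def subgraph_def delete_edge_def)
    then show ?thesis using F by (simp add: path_factor_ge_def path_factor_def)
  qed
  ultimately show ?thesis
    using pair_graph_delete_verts[OF assms(1)]
    unfolding path_factor_critical_avoidable_def path_factor_avoidable_def by blast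
qed

end
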